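(* Let $\mathbb K$ be a finite field and let $V$ be a vector space over $\mathbb K$ of finite dimension $n\ge 5$ with $n\equiv 4\pmod 6$. Then, for every hyperplane $H$ of $\mathcal G_3(V)$, the upper radical $R^\uparrow(H)$ is not a line-spread of $\mathrm{PG}(V)$.
   Context: For $1\le k<n=\dim V$, $\mathcal G_k(V)$ is the point-line geometry whose points are the $k$-dimensional subspaces of $V$ and whose lines are the sets $\{X : Y\subset X\subset Z,\ \dim X=k\}$ with $Y\subset Z$ subspaces of $V$, $\dim Y=k-1$, $\dim Z=k+1$. A subspace of $\mathcal G_k(V)$ is a set $S$ of points containing every line that meets $S$ in at least two points; a hyperplane of $\mathcal G_k(V)$ is a proper subspace meeting every line non-trivially. It is known (Shult) that the hyperplanes of $\mathcal G_k(V)$ are exactly the sets of $k$-subspaces of $V$ on which a given non-trivial alternating $k$-linear form $\varphi$ on $V$ identically vanishes, $\varphi$ being unique up to a non-zero scalar. The upper radical $R^\uparrow(H)$ of a hyperplane $H$ of $\mathcal G_3(V)$ is the set of $2$-dimensional subspaces $A$ of $V$ such that every $3$-dimensional subspace of $V$ containing $A$ belongs to $H$. It is a (line-)spread of $\mathrm{PG}(V)$ if every $1$-dimensional subspace of $V$ is contained in exactly one member of $R^\uparrow(H)$. *)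

theory Defs
  imports Complex_Main "HOL-Number_Theory.Cong"
begin

section \<open>Point-line geometries\<close>

definition geometry_subspace :: "'p set \<Rightarrow> 'p set set \<Rightarrow> 'p set \<Rightarrow> bool" where
  "geometry_subspace P L S \<longleftrightarrow>
     S \<subseteq> P \<and> (\<forall>l\<in>L. (\<exists>x y. x \<noteq> y \<and> x \<in> l \<inter> S \<and> y \<in> l \<inter> S) \<longrightarrow> l \<subseteq> S)"

definition geometry_hyperplane :: "'p set \<Rightarrow> 'p set set \<Rightarrow> 'p set \<Rightarrow> bool" where
  "geometry_hyperplane P L H \<longleftrightarrow>
     geometry_subspace P L H \<and> H \<noteq> P \<and> (\<forall>l\<in>L. l \<inter> H \<noteq> {})"

section \<open>Grassmannians\<close>

text \<open>
  The ambient space \<open>V\<close> is the whole type \<open>'b\<close> of the locale \<open>vector_space\<close>. The definitions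
  are meant for finite-dimensional \<open>V\<close>; in general \<open>dim\<close> is \<open>0\<close> on infinite-dimensional
  subspaces. The prefix \<open>local\<close> is needed because the interpretation of the locale for real vector
  spaces makes the unqualified names refer to the real instance.
\<close>

context vector_space
begin

definition grassmann_points :: "nat \<Rightarrow> 'b set set" where
  "grassmann_points k = {X. subspace X \<and> dim X = k}"

text \<open>\<open>dim Y + 1 = k\<close> expresses \<open>dim Y = k - 1\<close> without truncated subtraction.\<close>

definition grassmann_lines :: "nat \<Rightarrow> 'b set set set" where
  "grassmann_lines k =
     {{X \<in> local.grassmann_points k. Y \<subset> X \<and> X \<subset> Z} | Y Z.
        subspace Y \<and> subspace Z \<and> Y \<subset> Z \<and> dim Y + 1 = k \<and> dim Z = k + 1}"

definition grassmann_hyperplane :: "nat \<Rightarrow> 'b set set \<Rightarrow> bool" where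
  "grassmann_hyperplane k H \<longleftrightarrow>
     geometry_hyperplane (local.grassmann_points k) (local.grassmann_lines k) H"

text \<open>Here \<open>H\<close> is meant to be a hyperplane of the Grassmannian of 3-subspaces.\<close>

definition upper_radical :: "'b set set \<Rightarrow> 'b set set" where
  "upper_radical H =
     {A \<in> local.grassmann_points 2. \<forall>X \<in> local.grassmann_points 3. A \<subseteq> X \<longrightarrow> X \<in> H}"

definition line_spread :: "'b set set \<Rightarrow> bool" where
  "line_spread S \<longleftrightarrow>
     S \<subseteq> local.grassmann_points 2 \<and> (\<forall>p \<in> local.grassmann_points 1. \<exists>!A. A \<in> S \<and> p \<subseteq> A)"

end

end

theory Submission
  imports Defs
begin

text \<open>
  Let \<open>q\<close> be the order of the field, and suppose that the upper radical of \<open>H\<close> is a line spread. The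
  proof counts in two ways the ordered triples \<open>(a, b, c)\<close> of linearly independent vectors whose
  span is not in \<open>H\<close>, and obtains a contradiction modulo \<open>q\<^sup>2 + q + 1\<close>.

  Grouped by span, the triples fall into classes of size \<open>(q\<^sup>3 - 1)(q\<^sup>3 - q)(q\<^sup>3 - q\<^sup>2)\<close>, one for each
  3-subspace outside \<open>H\<close>, so this product divides their number (\<open>card_triples_outside_by_span\<close>).

  Alternatively, choose the vectors one after the other. For a 2-subspace \<open>A\<close>, let \<open>W\<close> consist of
  the vectors of \<open>A\<close> and of the vectors \<open>x\<close> for which \<open>\<langle>A, x\<rangle>\<close> is in \<open>H\<close>. The 3-subspaces on \<open>A\<close>
  and the lines of the Grassmannian between them form the projective space of \<open>V/A\<close>, and the axioms
  for \<open>H\<close> say that \<open>W/A\<close> is all of it or a hyperplane of it. So either \<open>A\<close> is in the upper radical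
  and no \<open>c\<close> completes a basis of \<open>A\<close> to a triple of the required kind, or exactly
  \<open>q\<^sup>n - q\<^sup>n\<^sup>-\<^sup>1\<close> vectors \<open>c\<close> do (\<open>card_extension_locus\<close>). Since a nonzero vector \<open>a\<close> lies in
  exactly one 2-subspace of the spread, the admissible \<open>b\<close> are the \<open>q\<^sup>n - q\<^sup>2\<close> vectors outside it.
  Hence there are \<open>(q\<^sup>n - 1)(q\<^sup>n - q\<^sup>2)(q\<^sup>n - q\<^sup>n\<^sup>-\<^sup>1)\<close> triples (\<open>card_triples_outside_by_spread\<close>).

  Since \<open>n \<equiv> 1\<close> modulo 3 and \<open>n > 1\<close>, this number is not divisible by \<open>q\<^sup>2 + q + 1\<close>, whereas
  \<open>q\<^sup>3 - 1\<close> is (\<open>triple_count_not_divisible\<close>).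
\<close>

section \<open>Vector spaces over a finite field\<close>

lemma card_Sigma_constant:
  assumes "finite A" "\<And>a. a \<in> A \<Longrightarrow> finite (B a)" "\<And>a. a \<in> A \<Longrightarrow> card (B a) = m"
  shows "card (Sigma A B) = card A * m"
  using assms by simp

text \<open>
  The order of the field is a parameter because an abbreviation for it would have to carry the type
  of the field as an argument.
\<close>
locale finite_vector_space = finite_dimensional_vector_space scale Basis
  for scale :: "'k::{field, finite} \<Rightarrow> 'v::ab_group_add \<Rightarrow> 'v" (infixr "*s" 75)
    and Basis :: "'v set" +
  fixes q :: nat
  assumes card_field: "card (UNIV :: 'k set) = q"
begin

lemma q_ge_2: "q \<ge> 2"
proof -
  have "card {0, 1 :: 'k} \<le> q"
    unfolding card_field[symmetric] by (intro card_mono) auto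
  then show ?thesis by simp
qed

lemma card_span_insert:
  assumes "a \<notin> local.span S"
  shows "card (local.span (insert a S)) = q * card (local.span S)"
proof -
  let ?f = "\<lambda>(k, x). k *s a + x"
  have inj: "inj_on ?f (UNIV \<times> local.span S)"
  proof (rule inj_onI, clarify)
    fix k x l y
    assume x: "x \<in> local.span S" and y: "y \<in> local.span S" and eq: "k *s a + x = l *s a + y"
    have "(k - l) *s a = y - x"
      using eq by (simp add: scale_left_diff_distrib algebra_simps)
    then have "(k - l) *s a \<in> local.span S"
      using x y by (simp add: span_diff)
    then have "inverse (k - l) *s (k - l) *s a \<in> local.span S"
      by (rule span_scale)
    then have "k = l"
      using assms by (cases "k = l") auto
    then show "k = l \<and> x = y" using eq by simp
  qed
  have "?f ` (UNIV \<times> local.span S) = local.span (insert a S)"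
  proof (intro equalityI subsetI)
    fix v assume "v \<in> ?f ` (UNIV \<times> local.span S)"
    then show "v \<in> local.span (insert a S)"
      by (auto intro!: span_add span_scale intro: span_base span_mono[THEN subsetD, OF subset_insertI])
  next
    fix v assume "v \<in> local.span (insert a S)"
    then obtain k where "v - k *s a \<in> local.span S"
      by (auto simp: span_breakdown_eq)
    then show "v \<in> ?f ` (UNIV \<times> local.span S)"
      by (intro image_eqI[of _ _ "(k, v - k *s a)"]) auto
  qed
  then show ?thesis
    using card_image[OF inj] by (simp add: card_cartesian_product card_field)
qed

lemma card_span_independent:
  assumes "finite B" "local.independent B"
  shows "card (local.span B) = q ^ card B"
  using assms
proof (induction B rule: finite_induct)
  case empty
  then show ?case by simp
next
  case (insert a B)
  then have "a \<notin> local.span B" "local.independent B"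
    by (auto simp: independent_insert)
  then show ?case
    using insert by (simp add: card_span_insert)
qed

lemma card_subspace:
  assumes "local.subspace X"
  shows "card X = q ^ local.dim X"
proof -
  obtain B where B: "B \<subseteq> X" "local.independent B" "X \<subseteq> local.span B" "card B = local.dim X"
    using basis_exists by blast
  then have "local.span B = X"
    using assms by (metis span_minimal subset_antisym)
  then show ?thesis
    using B card_span_independent finiteI_independent by metis
qed

lemma finite_UNIV_vector: "finite (UNIV :: 'v set)"
proof (rule card_ge_0_finite)
  have "q > 0" using q_ge_2 by simp
  then show "card (UNIV :: 'v set) > 0"
    unfolding card_subspace[OF subspace_UNIV] by (rule zero_less_power)
qed

lemma finite_vectors: "finite (S :: 'v set)"
  by (rule finite_subset[OF subset_UNIV finite_UNIV_vector])

section \<open>Extending subspaces by one vector\<close>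

lemma subspace_eq_span_insert:
  assumes "local.subspace A" "local.subspace X" "A \<subseteq> X" "local.dim X = Suc (local.dim A)"
    and "w \<in> X" "w \<notin> A"
  shows "X = local.span (insert w A)"
proof -
  have "local.span (insert w A) \<subseteq> X"
    using assms by (intro span_minimal) auto
  moreover have "local.dim (local.span (insert w A)) = local.dim X"
    using assms by (simp add: dim_insert span_eq_iff[THEN iffD2])
  ultimately show ?thesis
    using assms subspace_dim_equal[of "local.span (insert w A)" X] by auto
qed

lemma grassmann_points_obtain_span_insert:
  assumes "A \<in> local.grassmann_points k" "X \<in> local.grassmann_points (Suc k)" "A \<subseteq> X"
  obtains w where "w \<notin> A" "X = local.span (insert w A)"
proof -
  have "A \<noteq> X" using assms by (auto simp: grassmann_points_def)
  then obtain w where "w \<in> X" "w \<notin> A" using assms by auto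
  then show ?thesis
    using assms subspace_eq_span_insert[of A X w] that by (auto simp: grassmann_points_def)
qed

lemma span_insert_in_grassmann_points:
  assumes "A \<in> local.grassmann_points k" "w \<notin> A"
  shows "local.span (insert w A) \<in> local.grassmann_points (Suc k)"
  using assms by (auto simp: grassmann_points_def dim_insert span_eq_iff[THEN iffD2])

lemma pencil_in_grassmann_lines:
  assumes "A \<in> local.grassmann_points k" "u \<notin> A" "v \<notin> local.span (insert u A)"
  shows "{X \<in> local.grassmann_points (Suc k). A \<subset> X \<and> X \<subset> local.span (insert v (insert u A))}
    \<in> local.grassmann_lines (Suc k)"
proof -
  have "local.dim (local.span (insert v (insert u A))) = Suc (Suc k)"
    using assms by (auto simp: grassmann_points_def dim_insert span_eq_iff[THEN iffD2])
  moreover have "A \<subset> local.span (insert v (insert u A))"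
    using assms(2) span_superset[of "insert v (insert u A)"] by blast
  ultimately show ?thesis
    using assms(1) unfolding grassmann_lines_def
    by (intro CollectI exI[of _ A] exI[of _ "local.span (insert v (insert u A))"])
      (auto simp: grassmann_points_def)
qed

section \<open>The local structure of a hyperplane\<close>

text \<open>
  The quotient of this set by \<open>A\<close> is the point set that \<open>H\<close> cuts out in the projective space of
  \<open>V/A\<close>. Working with its preimage in \<open>V\<close> avoids quotient spaces; \<open>A\<close> itself has to be added
  because its vectors do not extend \<open>A\<close>.
\<close>
definition extension_locus :: "'v set set \<Rightarrow> 'v set \<Rightarrow> 'v set" where
  "extension_locus H A = {x. x \<in> A \<or> local.span (insert x A) \<in> H}"

lemma subset_extension_locus: "A \<subseteq> extension_locus H A"
  by (auto simp: extension_locus_def)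

lemma mem_extension_locus_if_in_span:
  assumes "A \<in> local.grassmann_points k" "x \<in> extension_locus H A" "y \<in> local.span (insert x A)"
  shows "y \<in> extension_locus H A"
proof (cases "x \<in> A \<or> y \<in> A")
  case True
  then show ?thesis
    using assms by (auto simp: extension_locus_def grassmann_points_def insert_absorb
        span_eq_iff[THEN iffD2])
next
  case False
  have "local.span (insert x A) = local.span (insert y A)"
    using assms False span_insert_in_grassmann_points[OF assms(1), of x]
    by (intro subspace_eq_span_insert) (auto simp: grassmann_points_def intro: span_base)
  then show ?thesis
    using assms False by (auto simp: extension_locus_def)
qed

text \<open>
  Closure under addition reflects that \<open>H\<close> is a geometric subspace: if \<open>x\<close> and \<open>y\<close> are independent
  modulo \<open>A\<close>, then \<open>\<langle>A, x\<rangle>\<close>, \<open>\<langle>A, y\<rangle>\<close> and \<open>\<langle>A, x + y\<rangle>\<close> lie on a common line, and the first two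
  being in \<open>H\<close> forces the third into \<open>H\<close>.
\<close>
lemma subspace_extension_locus:
  assumes H: "local.grassmann_hyperplane (Suc k) H" and A: "A \<in> local.grassmann_points k"
  shows "local.subspace (extension_locus H A)"
proof (rule subspaceI)
  have sub: "local.subspace A" using A by (simp add: grassmann_points_def)
  show "0 \<in> extension_locus H A"
    using sub subset_extension_locus subspace_0 by blast
  show "c *s x \<in> extension_locus H A" if "x \<in> extension_locus H A" for c x
    by (rule mem_extension_locus_if_in_span[OF A that]) (simp add: span_scale span_base)
  show "x + y \<in> extension_locus H A" if x: "x \<in> extension_locus H A" and y: "y \<in> extension_locus H A"
    for x y
  proof (cases "y \<in> local.span (insert x A) \<or> x \<in> A")
    case True
    then show ?thesis
    proof
      assume "y \<in> local.span (insert x A)"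
      then show ?thesis
        by (intro mem_extension_locus_if_in_span[OF A x] span_add) (auto intro: span_base)
    next
      assume "x \<in> A"
      then show ?thesis
        by (intro mem_extension_locus_if_in_span[OF A y] span_add) (auto intro: span_base)
    qed
  next
    case False
    let ?Z = "local.span (insert y (insert x A))"
    let ?l = "{X \<in> local.grassmann_points (Suc k). A \<subset> X \<and> X \<subset> ?Z}"
    have dimZ: "local.dim ?Z = Suc (Suc k)"
      using A False by (auto simp: grassmann_points_def dim_insert span_eq_iff[THEN iffD2])
    have on_line: "local.span (insert w A) \<in> ?l" if "w \<in> ?Z" "w \<notin> A" for w
    proof -
      have "local.span (insert w A) \<in> local.grassmann_points (Suc k)"
        using A that by (intro span_insert_in_grassmann_points)
      moreover have "local.span (insert w A) \<subseteq> ?Z"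
        using that by (intro span_minimal) (auto intro: span_base)
      moreover have "local.span (insert w A) \<noteq> ?Z"
      proof
        assume "local.span (insert w A) = ?Z"
        then have "local.dim (local.span (insert w A)) = local.dim ?Z" by (rule arg_cong)
        then show False
          using calculation(1) unfolding dimZ grassmann_points_def by simp
      qed
      moreover have "A \<subset> local.span (insert w A)"
        using that span_superset[of "insert w A"] by blast
      ultimately show ?thesis by blast
    qed
    have "y \<notin> A" using False by (auto intro: span_base)
    have "x + y \<notin> A"
    proof
      assume "x + y \<in> A"
      then have "(x + y) - x \<in> local.span (insert x A)"
        by (intro span_diff) (auto intro: span_base)
      then show False using False by simp
    qed
    have line: "?l \<in> local.grassmann_lines (Suc k)"
      using A False by (intro pencil_in_grassmann_lines) auto
    have "local.span (insert x A) \<in> ?l \<inter> H"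
      using on_line[of x] x False by (auto simp: extension_locus_def intro: span_base)
    moreover have "local.span (insert y A) \<in> ?l \<inter> H"
      using on_line[of y] y \<open>y \<notin> A\<close> by (auto simp: extension_locus_def intro: span_base)
    moreover have "local.span (insert x A) \<noteq> local.span (insert y A)"
      using False by (metis insertI1 span_base)
    ultimately have "\<exists>X Y. X \<noteq> Y \<and> X \<in> ?l \<inter> H \<and> Y \<in> ?l \<inter> H"
      by (intro exI conjI)
    then have "?l \<subseteq> H"
      using H line unfolding grassmann_hyperplane_def geometry_hyperplane_def geometry_subspace_def
      by (elim conjE) (drule (1) bspec, drule (1) mp)
    moreover have "local.span (insert (x + y) A) \<in> ?l"
      using \<open>x + y \<notin> A\<close> by (intro on_line span_add) (auto intro: span_base)
    ultimately show ?thesis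
      by (auto simp: extension_locus_def)
  qed
qed

text \<open>
  Since \<open>H\<close> meets every line, the line through \<open>\<langle>A, u\<rangle>\<close> and \<open>\<langle>A, v\<rangle>\<close> has a point \<open>\<langle>A, w\<rangle>\<close> in \<open>H\<close>,
  which differs from \<open>\<langle>A, u\<rangle>\<close>. By exchange, \<open>v\<close> is in the span of \<open>u\<close>, \<open>w\<close> and \<open>A\<close>, so the
  single vector \<open>u\<close> complements the locus and its index in \<open>V\<close> is \<open>q\<close>.
\<close>
lemma card_extension_locus:
  assumes H: "local.grassmann_hyperplane (Suc k) H" and A: "A \<in> local.grassmann_points k"
    and u: "u \<notin> extension_locus H A"
  shows "q * card (extension_locus H A) = card (UNIV :: 'v set)"
proof -
  let ?W = "extension_locus H A"
  have W: "local.span ?W = ?W"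
    using subspace_extension_locus[OF H A] by (simp add: span_eq_iff)
  have uA: "u \<notin> A" using u subset_extension_locus by blast
  have "v \<in> local.span (insert u ?W)" for v
  proof (cases "v \<in> local.span (insert u A)")
    case True
    then show ?thesis
      using subset_extension_locus span_mono[of "insert u A" "insert u ?W"] by blast
  next
    case False
    let ?Z = "local.span (insert v (insert u A))"
    let ?l = "{X \<in> local.grassmann_points (Suc k). A \<subset> X \<and> X \<subset> ?Z}"
    have "?l \<in> local.grassmann_lines (Suc k)"
      using A uA False by (rule pencil_in_grassmann_lines)
    then have "?l \<inter> H \<noteq> {}"
      using H unfolding grassmann_hyperplane_def geometry_hyperplane_def by blast
    then obtain X where X: "X \<in> ?l" "X \<in> H" by blast
    then obtain w where w: "w \<notin> A" "X = local.span (insert w A)"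
      using grassmann_points_obtain_span_insert[OF A, of X] by auto
    have wW: "w \<in> ?W" using w X by (simp add: extension_locus_def)
    have w_notin: "w \<notin> local.span (insert u A)"
    proof
      assume *: "w \<in> local.span (insert u A)"
      have "local.span (insert u A) = X"
        unfolding w(2)
        using A w * uA span_insert_in_grassmann_points[OF A, of u]
        by (intro subspace_eq_span_insert) (auto simp: grassmann_points_def intro: span_base)
      then show False using u X by (simp add: extension_locus_def)
    qed
    have "w \<in> ?Z" using X w by (auto intro: span_base)
    then have "v \<in> local.span (insert w (insert u A))"
      using w_notin by (rule in_span_insert)
    moreover have "insert w (insert u A) \<subseteq> insert u ?W"
      using wW subset_extension_locus by auto
    ultimately show ?thesis using span_mono by blast
  qed
  then have "local.span (insert u ?W) = UNIV" by auto
  then show ?thesis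
    using card_span_insert[of u ?W] u W by simp
qed

section \<open>Counting triples of independent vectors\<close>

lemma span_insert_span: "local.span (insert x (local.span S)) = local.span (insert x S)"
  by (intro equalityI span_minimal insert_subsetI span_mono)
    (auto intro: span_base span_superset[THEN subsetD] subsetD[OF span_mono[OF subset_insertI]])

lemma span_singleton_in_grassmann_points:
  "a \<noteq> 0 \<Longrightarrow> local.span {a} \<in> local.grassmann_points 1"
  using span_insert_in_grassmann_points[of "{0}" 0 a] span_insert_span[of a "{}"]
  by (simp add: grassmann_points_def)

lemma span_pair_in_grassmann_points:
  "\<lbrakk>a \<noteq> 0; b \<notin> local.span {a}\<rbrakk> \<Longrightarrow> local.span {b, a} \<in> local.grassmann_points 2"
  using span_insert_in_grassmann_points[OF span_singleton_in_grassmann_points, of a b]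
  by (simp add: span_insert_span numeral_2_eq_2)

lemma span_triple_in_grassmann_points:
  "\<lbrakk>a \<noteq> 0; b \<notin> local.span {a}; c \<notin> local.span {b, a}\<rbrakk>
    \<Longrightarrow> local.span {c, b, a} \<in> local.grassmann_points 3"
  using span_insert_in_grassmann_points[OF span_pair_in_grassmann_points, of a b c]
  by (simp add: span_insert_span numeral_3_eq_3)

definition frames :: "'v set \<Rightarrow> ('v \<times> 'v \<times> 'v) set" where
  "frames X = (SIGMA a : X - {0}. SIGMA b : X - local.span {a}. X - local.span {b, a})"

lemma card_frames:
  assumes X: "X \<in> local.grassmann_points 3"
  shows "card (frames X) = (q ^ 3 - 1) * ((q ^ 3 - q) * (q ^ 3 - q ^ 2))"
proof -
  have sub: "local.subspace X" and cX: "card X = q ^ 3"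
    using X card_subspace by (auto simp: grassmann_points_def)
  have c1: "card (X - {0}) = q ^ 3 - 1"
    using sub by (simp add: cX subspace_0)
  have c2: "card (X - local.span {a}) = q ^ 3 - q" if "a \<in> X - {0}" for a
  proof -
    have "local.span {a} \<subseteq> X" using that sub by (intro span_minimal) auto
    then have "card (X - local.span {a}) = card X - card (local.span {a})"
      by (rule card_Diff_subset[OF finite_vectors])
    also have "card (local.span {a}) = q"
      using that by (subst card_span_insert) auto
    finally show ?thesis by (simp add: cX)
  qed
  have c3: "card (X - local.span {b, a}) = q ^ 3 - q ^ 2"
    if "a \<in> X - {0}" "b \<in> X - local.span {a}" for a b
  proof -
    have "local.span {b, a} \<subseteq> X" using that sub by (intro span_minimal) auto
    then have "card (X - local.span {b, a}) = card X - card (local.span {b, a})"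
      by (rule card_Diff_subset[OF finite_vectors])
    also have "card (local.span {b, a}) = q ^ 2"
      using that by (simp add: card_span_insert power2_eq_square)
    finally show ?thesis by (simp add: cX)
  qed
  show ?thesis
    unfolding frames_def c1[symmetric]
    by (intro card_Sigma_constant) (auto simp: finite_vectors c2[simplified] c3[simplified])
qed

lemma span_eq_if_frame:
  assumes "X \<in> local.grassmann_points 3" "(a, b, c) \<in> frames X"
  shows "X = local.span {c, b, a}"
proof -
  have "local.span {c, b, a} \<subseteq> X"
    using assms by (intro span_minimal) (auto simp: frames_def grassmann_points_def)
  then show ?thesis
    using assms span_triple_in_grassmann_points[of a b c]
      subspace_dim_equal[of "local.span {c, b, a}" X]
    by (auto simp: frames_def grassmann_points_def)
qed

definition triples_outside :: "'v set set \<Rightarrow> ('v \<times> 'v \<times> 'v) set" where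
  "triples_outside H = {(a, b, c) \<in> frames UNIV. local.span {c, b, a} \<notin> H}"

lemma card_triples_outside_by_span:
  "card (triples_outside H) =
    card (local.grassmann_points 3 - H) * ((q ^ 3 - 1) * ((q ^ 3 - q) * (q ^ 3 - q ^ 2)))"
proof -
  have "triples_outside H = (\<Union>X \<in> local.grassmann_points 3 - H. frames X)"
  proof (intro equalityI subsetI)
    fix t assume "t \<in> triples_outside H"
    then obtain a b c where t: "t = (a, b, c)" "(a, b, c) \<in> frames UNIV"
      and out: "local.span {c, b, a} \<notin> H"
      by (auto simp: triples_outside_def)
    then have "local.span {c, b, a} \<in> local.grassmann_points 3"
      by (intro span_triple_in_grassmann_points) (auto simp: frames_def)
    moreover have "t \<in> frames (local.span {c, b, a})"
      using t by (auto simp: frames_def intro: span_base)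
    ultimately show "t \<in> (\<Union>X \<in> local.grassmann_points 3 - H. frames X)"
      using out by blast
  next
    fix t assume "t \<in> (\<Union>X \<in> local.grassmann_points 3 - H. frames X)"
    then obtain X a b c where "X \<in> local.grassmann_points 3" "X \<notin> H"
      "t = (a, b, c)" "(a, b, c) \<in> frames X"
      by (metis DiffE UN_E prod_cases3)
    then show "t \<in> triples_outside H"
      using span_eq_if_frame[of X a b c] by (auto simp: triples_outside_def frames_def)
  qed
  also have "card \<dots> = (\<Sum>X \<in> local.grassmann_points 3 - H. card (frames X))"
  proof (rule card_UN_disjoint)
    show "finite (local.grassmann_points 3 - H)"
      using finite_UNIV_vector by (metis Finite_Set.finite_set finite_subset subset_UNIV)
    show "\<forall>X \<in> local.grassmann_points 3 - H. finite (frames X)"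
      by (auto simp: frames_def finite_vectors)
    show "\<forall>X \<in> local.grassmann_points 3 - H. \<forall>Y \<in> local.grassmann_points 3 - H.
        X \<noteq> Y \<longrightarrow> frames X \<inter> frames Y = {}"
    proof (intro ballI impI equals0I)
      fix X Y t
      assume "X \<in> local.grassmann_points 3 - H" "Y \<in> local.grassmann_points 3 - H" "X \<noteq> Y"
        and "t \<in> frames X \<inter> frames Y"
      then show False
        by (cases t) (metis DiffD1 IntD1 IntD2 span_eq_if_frame)
    qed
  qed
  also have "\<dots> = card (local.grassmann_points 3 - H) *
      ((q ^ 3 - 1) * ((q ^ 3 - q) * (q ^ 3 - q ^ 2)))"
    by (simp add: card_frames)
  finally show ?thesis .
qed

text \<open>
  The spread controls the choice of the second vector: for \<open>b\<close> outside \<open>\<langle>a\<rangle>\<close>, the span of \<open>a\<close> and \<open>b\<close>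
  is in the upper radical exactly when \<open>b\<close> lies in the unique spread element \<open>L a\<close> on \<open>a\<close>.
\<close>
lemma card_triples_outside_by_spread:
  assumes H: "local.grassmann_hyperplane 3 H"
    and spread: "local.line_spread (local.upper_radical H)"
    and n: "local.dim (UNIV :: 'v set) = Suc n"
  shows "card (triples_outside H) =
    (q ^ Suc n - 1) * ((q ^ Suc n - q ^ 2) * (q ^ Suc n - q ^ n))"
proof -
  let ?R = "local.upper_radical H"
  have cV: "card (UNIV :: 'v set) = q ^ Suc n"
    using card_subspace[OF subspace_UNIV] n by simp
  have "\<forall>a\<in>-{0}. \<exists>A. A \<in> ?R \<and> local.span {a} \<subseteq> A \<and> (\<forall>A'. A' \<in> ?R \<and> local.span {a} \<subseteq> A' \<longrightarrow> A' = A)"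
  proof
    fix a :: 'v assume "a \<in> -{0}"
    then have "local.span {a} \<in> local.grassmann_points 1"
      by (intro span_singleton_in_grassmann_points) simp
    then have "\<exists>!A. A \<in> ?R \<and> local.span {a} \<subseteq> A"
      using spread unfolding line_spread_def by blast
    then show "\<exists>A. A \<in> ?R \<and> local.span {a} \<subseteq> A \<and> (\<forall>A'. A' \<in> ?R \<and> local.span {a} \<subseteq> A' \<longrightarrow> A' = A)"
      by (elim ex1E) blast
  qed
  then obtain L where L_spec: "\<forall>a\<in>-{0}. L a \<in> ?R \<and> local.span {a} \<subseteq> L a \<and>
      (\<forall>A'. A' \<in> ?R \<and> local.span {a} \<subseteq> A' \<longrightarrow> A' = L a)"
    using bchoice by metis
  then have L: "L a \<in> ?R" "local.span {a} \<subseteq> L a"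
    and L_unique: "\<lbrakk>A \<in> ?R; local.span {a} \<subseteq> A\<rbrakk> \<Longrightarrow> A = L a" if "a \<noteq> 0" for a A
    using that by simp_all
  have L2: "L a \<in> local.grassmann_points 2" if "a \<noteq> 0" for a
    using L(1)[OF that] by (simp add: upper_radical_def)
  have L_eq: "L a = local.span {b, a}" if "a \<noteq> 0" "b \<in> L a" "b \<notin> local.span {a}" for a b
  proof -
    have "L a = local.span (insert b (local.span {a}))"
      using L L2 that span_singleton_in_grassmann_points[of a]
      by (intro subspace_eq_span_insert) (auto simp: grassmann_points_def)
    then show ?thesis by (simp add: span_insert_span)
  qed
  have "triples_outside H =
    (SIGMA a : -{0}. SIGMA b : - L a. - extension_locus H (local.span {b, a}))"
  proof (rule set_eqI, clarify)
    fix a b c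
    \<comment> \<open>If \<open>b\<close> were in \<open>L a\<close>, then \<open>\<langle>a, b\<rangle> = L a\<close> would be in the upper radical, and every 3-subspace
      on it in \<open>H\<close>.\<close>
    have "b \<notin> L a" if "a \<noteq> 0" "b \<notin> local.span {a}" "c \<notin> local.span {b, a}" "local.span {c, b, a} \<notin> H"
    proof
      assume "b \<in> L a"
      then have "local.span {b, a} \<in> ?R" using L L_eq that by metis
      moreover have "local.span {b, a} \<subseteq> local.span {c, b, a}" by (intro span_mono) auto
      ultimately show False
        using that span_triple_in_grassmann_points[of a b c] by (auto simp: upper_radical_def)
    qed
    then show "(a, b, c) \<in> triples_outside H \<longleftrightarrow>
      (a, b, c) \<in> (SIGMA a : -{0}. SIGMA b : - L a. - extension_locus H (local.span {b, a}))"
      using L by (auto simp: triples_outside_def frames_def extension_locus_def span_insert_span)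
  qed
  also have "card \<dots> = card (-{0::'v}) * ((q ^ Suc n - q ^ 2) * (q ^ Suc n - q ^ n))"
  proof (rule card_Sigma_constant[OF finite_vectors])
    fix a :: 'v assume "a \<in> -{0}"
    then have a: "a \<noteq> 0" by simp
    show "finite (SIGMA b : - L a. - extension_locus H (local.span {b, a}))"
      by (auto simp: finite_vectors)
    have "card (- extension_locus H (local.span {b, a})) = q ^ Suc n - q ^ n" if b: "b \<in> - L a" for b
    proof -
      let ?A = "local.span {b, a}"
      have "?A \<notin> ?R"
        using L_unique[OF a, of ?A] b span_mono[of "{a}" "{b, a}"] span_base[of b "{b, a}"] by auto
      moreover have A2: "?A \<in> local.grassmann_points 2"
        using a b L(2) by (intro span_pair_in_grassmann_points) auto
      ultimately obtain X where X: "X \<in> local.grassmann_points 3" "?A \<subseteq> X" "X \<notin> H"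
        by (auto simp: upper_radical_def)
      then obtain u where "u \<notin> ?A" "X = local.span (insert u ?A)"
        using grassmann_points_obtain_span_insert[OF A2, of X] by (auto simp: numeral_3_eq_3 numeral_2_eq_2)
      then have "u \<notin> extension_locus H ?A" using X by (simp add: extension_locus_def)
      then have "q * card (extension_locus H ?A) = q * q ^ n"
        using card_extension_locus[of 2 H ?A u] H A2 cV by (simp add: numeral_3_eq_3 numeral_2_eq_2)
      then have "card (extension_locus H ?A) = q ^ n" using q_ge_2 by simp
      then show ?thesis
        by (simp add: Compl_eq_Diff_UNIV card_Diff_subset[OF finite_vectors] cV)
    qed
    then have "card (SIGMA b : - L a. - extension_locus H (local.span {b, a})) =
      card (- L a) * (q ^ Suc n - q ^ n)"
      by (rule card_Sigma_constant[OF finite_vectors finite_vectors])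
    moreover have "card (- L a) = q ^ Suc n - q ^ 2"
      using card_subspace[of "L a"] L2[OF a]
      by (simp add: Compl_eq_Diff_UNIV card_Diff_subset[OF finite_vectors] cV grassmann_points_def)
    ultimately show "card (SIGMA b : - L a. - extension_locus H (local.span {b, a})) =
      (q ^ Suc n - q ^ 2) * (q ^ Suc n - q ^ n)"
      by simp
  qed
  also have "card (-{0::'v}) = q ^ Suc n - 1"
    by (simp add: Compl_eq_Diff_UNIV card_Diff_subset[OF finite_vectors] cV)
  finally show ?thesis .
qed

end

section \<open>The arithmetic contradiction\<close>

text \<open>
  Let \<open>m = q\<^sup>2 + q + 1\<close>, a divisor of \<open>q\<^sup>3 - 1\<close> and hence of the right-hand side. Modulo \<open>m\<close> the power
  \<open>q\<^sup>3\<^sup>t\<close> is 1, so the left-hand side becomes \<open>(q - 1)(q - q\<^sup>2)(q - 1) = - q (q - 1)\<^sup>3\<close>. Because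
  \<open>(q - 1)\<^sup>2 \<equiv> - 3 q\<close> and \<open>q\<^sup>3 \<equiv> 1\<close>, this times \<open>q\<close> is congruent to \<open>3 (q - 1)\<close>, which is positive and
  smaller than \<open>m\<close>.
\<close>
lemma triple_count_not_divisible:
  fixes q t N :: nat
  assumes "q \<ge> 2" "t > 0"
  shows "(q ^ Suc (3 * t) - 1) * ((q ^ Suc (3 * t) - q ^ 2) * (q ^ Suc (3 * t) - q ^ (3 * t)))
    \<noteq> N * ((q ^ 3 - 1) * ((q ^ 3 - q) * (q ^ 3 - q ^ 2)))"
proof
  assume eq: "(q ^ Suc (3 * t) - 1) * ((q ^ Suc (3 * t) - q ^ 2) * (q ^ Suc (3 * t) - q ^ (3 * t)))
    = N * ((q ^ 3 - 1) * ((q ^ 3 - q) * (q ^ 3 - q ^ 2)))"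
  \<comment> \<open>The summands 1 and \<open>q\<close> are written as powers so that \<open>int_diff\<close> below removes every truncated
    subtraction.\<close>
  have eq': "(q ^ Suc (3 * t) - q ^ 0) * ((q ^ Suc (3 * t) - q ^ 2) * (q ^ Suc (3 * t) - q ^ (3 * t)))
    = N * ((q ^ 3 - q ^ 0) * ((q ^ 3 - q ^ 1) * (q ^ 3 - q ^ 2)))"
    using eq by simp
  define Q r m where "Q = int q" and "r = Q ^ (3 * t)" and "m = Q ^ 2 + Q + 1"
  have Q: "Q \<ge> 2" using assms by (simp add: Q_def)
  have int_diff: "int (q ^ i - q ^ j) = Q ^ i - Q ^ j" if "j \<le> i" for i j
    using assms that by (simp add: Q_def of_nat_diff power_increasing)
  have "(Q ^ Suc (3 * t) - Q ^ 0) * ((Q ^ Suc (3 * t) - Q ^ 2) * (Q ^ Suc (3 * t) - Q ^ (3 * t)))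
    = int N * ((Q ^ 3 - Q ^ 0) * ((Q ^ 3 - Q ^ 1) * (Q ^ 3 - Q ^ 2)))"
    using arg_cong[OF eq', of int] assms(2)
    by (simp only: of_nat_mult) (subst (asm) int_diff, simp)+
  moreover have "Q ^ 3 - 1 = m * (Q - 1)"
    by (simp add: m_def algebra_simps power2_eq_square power3_eq_cube)
  ultimately have "(Q * r - 1) * ((Q * r - Q ^ 2) * (Q * r - r))
    = m * ((Q - 1) * (int N * ((Q ^ 3 - Q) * (Q ^ 3 - Q ^ 2))))"
    by (simp add: r_def)
  then have "[(Q * r - 1) * ((Q * r - Q ^ 2) * (Q * r - r)) = 0] (mod m)"
    by (simp add: cong_0_iff)
  moreover have "[Q ^ 3 = 1] (mod m)"
    using \<open>Q ^ 3 - 1 = m * (Q - 1)\<close> by (simp add: cong_iff_dvd_diff)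
  then have "[r = 1] (mod m)"
    unfolding r_def power_mult by (metis cong_pow power_one)
  then have "[(Q * r - 1) * ((Q * r - Q ^ 2) * (Q * r - r)) =
      (Q * 1 - 1) * ((Q * 1 - Q ^ 2) * (Q * 1 - 1))] (mod m)"
    by (intro cong_mult cong_diff cong_refl)
  ultimately have "[(Q * 1 - 1) * ((Q * 1 - Q ^ 2) * (Q * 1 - 1)) = 0] (mod m)"
    using cong_sym cong_trans by blast
  then have "m dvd Q * ((Q - 1) * ((Q - Q ^ 2) * (Q - 1)))"
    by (simp add: cong_0_iff)
  moreover have "3 * (Q - 1) =
      Q * ((Q - 1) * ((Q - Q ^ 2) * (Q - 1))) + m * (Q ^ 2 * (Q - 1) - 3 * (Q - 1) ^ 2)"
    unfolding m_def by algebra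
  ultimately have "m dvd 3 * (Q - 1)" by simp
  then have "m \<le> 3 * (Q - 1)" using Q by (intro zdvd_imp_le) auto
  moreover have "m - 3 * (Q - 1) = (Q - 1) ^ 2 + 3"
    by (simp add: m_def power2_eq_square algebra_simps)
  ultimately show False using zero_le_power2[of "Q - 1"] by linarith
qed

theorem theorem1p7:
  fixes scale :: "'k::{field, finite} \<Rightarrow> 'v::ab_group_add \<Rightarrow> 'v"
    and Basis :: "'v set"
    and n :: nat
    and H :: "'v set set"
  assumes "finite_dimensional_vector_space scale Basis"
    and "vector_space.dim scale (UNIV :: 'v set) = n"
    and "n \<ge> 5"
    and "[n = 4] (mod 6)"
    and "vector_space.grassmann_hyperplane scale 3 H"
  shows "\<not> vector_space.line_spread scale (vector_space.upper_radical scale H)"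
proof
  assume spread: "vector_space.line_spread scale (vector_space.upper_radical scale H)"
  interpret finite_vector_space scale Basis "card (UNIV :: 'k set)"
    using assms(1) by (intro finite_vector_space.intro finite_vector_space_axioms.intro refl)
  define t where "t = n div 3"
  have n: "n = Suc (3 * t)" and t: "t > 0"
    using assms(3,4) unfolding t_def cong_def by presburger+
  show False
    using triple_count_not_divisible[OF q_ge_2 t]
      card_triples_outside_by_spread[OF assms(5) spread assms(2)[unfolded n]]
      card_triples_outside_by_span[of H]
    by metis
qed

end
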